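(* Let $(T,S,N)$ be a relative Rota-Baxter-Nijenhuis structure on a LieYRep pair $((\mathfrak g,[\cdot,\cdot],[\![\cdot,\cdot,\cdot]\!]),(V;\rho,\mu))$. Then: (i) $T$ is a relative Rota-Baxter operator on the deformed Lie-Yamaguti algebra $(\mathfrak g,[\cdot,\cdot]_N,[\![\cdot,\cdot,\cdot]\!]_N)$ with respect to the representation $(V;\hat\rho,\hat\mu)$; (ii) $N\circ T$ is a relative Rota-Baxter operator on the Lie-Yamaguti algebra $(\mathfrak g,[\cdot,\cdot],[\![\cdot,\cdot,\cdot]\!])$ with respect to the representation $(V;\rho,\mu)$.
   Context: All vector spaces are finite-dimensional over a field $\mathbb K$ of characteristic $0$. A Lie-Yamaguti algebra is a vector space $\mathfrak g$ with a bilinear map $[\cdot,\cdot]:\wedge^2\mathfrak g\to\mathfrak g$ and a trilinear map $[\![\cdot,\cdot,\cdot]\!]:\wedge^2\mathfrak g\otimes\mathfrak g\to\mathfrak g$ such that for all $x,y,z,w,t\in\mathfrak g$: (1) $[[x,y],z]+[[y,z],x]+[[z,x],y]+[\![x,y,z]\!]+[\![y,z,x]\!]+[\![z,x,y]\!]=0$; (2) $[\![[x,y],z,w]\!]+[\![[y,z],x,w]\!]+[\![[z,x],y,w]\!]=0$; (3) $[\![x,y,[z,w]]\!]=[[\![x,y,z]\!],w]+[z,[\![x,y,w]\!]]$; (4) $[\![x,y,[\![z,w,t]\!]]\!]=[\![[\![x,y,z]\!],w,t]\!]+[\![z,[\![x,y,w]\!],t]\!]+[\![z,w,[\![x,y,t]\!]]\!]$.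 A representation $(V;\rho,\mu)$ of $\mathfrak g$ is a vector space $V$ with linear maps $\rho:\mathfrak g\to\mathfrak{gl}(V)$, $\mu:\otimes^2\mathfrak g\to\mathfrak{gl}(V)$ such that, with $D(x,y)=D_{\rho,\mu}(x,y):=\mu(y,x)-\mu(x,y)+[\rho(x),\rho(y)]-\rho([x,y])$, for all $x,y,z,w\in\mathfrak g$: $\mu([x,y],z)-\mu(x,z)\rho(y)+\mu(y,z)\rho(x)=0$; $\mu(x,[y,z])-\rho(y)\mu(x,z)+\rho(z)\mu(x,y)=0$; $\rho([\![x,y,z]\!])=[D(x,y),\rho(z)]$; $\mu(z,w)\mu(x,y)-\mu(y,w)\mu(x,z)-\mu(x,[\![y,z,w]\!])+D(y,z)\mu(x,w)=0$; $\mu([\![x,y,z]\!],w)+\mu(z,[\![x,y,w]\!])=[D(x,y),\mu(z,w)]$. A Lie-Yamaguti algebra together with a representation is called a LieYRep pair. Nijenhuis operator on a Lie-Yamaguti algebra: a linear map $N:\mathfrak g\to\mathfrak g$ such that, with $[x,y]_N=[Nx,y]+[x,Ny]-N[x,y]$ and $[\![x,y,z]\!]_N=[\![Nx,Ny,z]\!]+[\![x,Ny,Nz]\!]+[\![Nx,y,Nz]\!]-N([\![Nx,y,z]\!]+[\![x,Ny,z]\!]+[\![x,y,Nz]\!])+N^2[\![x,y,z]\!]$, one has $[Nx,Ny]=N[x,y]_N$ and $[\![Nx,Ny,Nz]\!]=N[\![x,y,z]\!]_N$. Then $(\mathfrak g,[\cdot,\cdot]_N,[\![\cdot,\cdot,\cdot]\!]_N)$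 is a Lie-Yamaguti algebra, called the deformed one. For $N\in\mathfrak{gl}(\mathfrak g)$, $S\in\mathfrak{gl}(V)$ put $\hat\rho(x)=\rho(Nx)+\rho(x)\circ S-S\circ\rho(x)$, $\hat\mu(x,y)=\mu(Nx,y)\circ S+\mu(x,Ny)\circ S+\mu(Nx,Ny)-S\circ(\mu(Nx,y)+\mu(x,Ny)+\mu(x,y)\circ S)+S^2\circ\mu(x,y)$. Nijenhuis structure on a LieYRep pair: $(N,S)$ such that $N$ is a Nijenhuis operator on $\mathfrak g$ and $\rho(Nx)\circ S=S\circ\hat\rho(x)$, $\mu(Nx,Ny)\circ S=S\circ\hat\mu(x,y)$ for all $x,y\in\mathfrak g$. In this case $(V;\hat\rho,\hat\mu)$ is a representation of $(\mathfrak g,[\cdot,\cdot]_N,[\![\cdot,\cdot,\cdot]\!]_N)$, whose associated map $D_{\hat\rho,\hat\mu}$ (computed with the bracket $[\cdot,\cdot]_N$) is $\hat D(x,y)=D(Nx,y)\circ S+D(x,Ny)\circ S+D(Nx,Ny)-S\circ(D(Nx,y)+D(x,Ny)+D(x,y)\circ S)+S^2\circ D(x,y)$. For a linear map $T:V\to\mathfrak g$ put $[u,v]^T=\rho(Tu)v-\rho(Tv)u$ and $[\![u,v,w]\!]^T=D(Tu,Tv)w+\mu(Tv,Tw)u-\mu(Tu,Tw)v$. $T$ is a relative Rota-Baxter operator on $\mathfrak g$ with respect to $(V;\rho,\mu)$ if $[Tu,Tv]=T[u,v]^T$ and $[\![Tu,Tv,Tw]\!]=T[\![u,v,w]\!]^T$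 for all $u,v,w\in V$ (the same definition applies to any Lie-Yamaguti algebra and representation). Further, $[u,v]^T_S=[Su,v]^T+[u,Sv]^T-S[u,v]^T$ and $[\![u,v,w]\!]^T_S=[\![Su,Sv,w]\!]^T+[\![Su,v,Sw]\!]^T+[\![u,Sv,Sw]\!]^T-S([\![Su,v,w]\!]^T+[\![u,Sv,w]\!]^T+[\![u,v,Sw]\!]^T)+S^2[\![u,v,w]\!]^T$. Relative Rota-Baxter-Nijenhuis structure: a triple $(T,S,N)$ where $(N,S)$ is a Nijenhuis structure on the pair, $T$ is a relative Rota-Baxter operator, and for all $u,v,w\in V$: $N\circ T=T\circ S$, $[u,v]^T_S=[u,v]^{N\circ T}$, $[\![u,v,w]\!]^T_S=[\![u,v,w]\!]^{N\circ T}$. *)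

theory Defs
  imports Complex_Main
begin

text \<open>
  Vector spaces are whole types, with the scalar multiplication as an explicit parameter (so that
  the base field is an arbitrary field of characteristic 0). Endomorphism-valued maps such as
  \<open>\<rho> : \<gg> \<rightarrow> gl(V)\<close> are curried functions, and operator identities are stated pointwise.
\<close>

definition bilinear_map ::
  "('k::field \<Rightarrow> 'a::ab_group_add \<Rightarrow> 'a) \<Rightarrow> ('k \<Rightarrow> 'b::ab_group_add \<Rightarrow> 'b) \<Rightarrow>
   ('k \<Rightarrow> 'c::ab_group_add \<Rightarrow> 'c) \<Rightarrow> ('a \<Rightarrow> 'b \<Rightarrow> 'c) \<Rightarrow> bool" where
  "bilinear_map sa sb sc f \<longleftrightarrow>
     (\<forall>y. Vector_Spaces.linear sa sc (\<lambda>x. f x y)) \<and> (\<forall>x. Vector_Spaces.linear sb sc (f x))"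

definition trilinear_map ::
  "('k::field \<Rightarrow> 'a::ab_group_add \<Rightarrow> 'a) \<Rightarrow> ('k \<Rightarrow> 'b::ab_group_add \<Rightarrow> 'b) \<Rightarrow>
   ('k \<Rightarrow> 'c::ab_group_add \<Rightarrow> 'c) \<Rightarrow> ('k \<Rightarrow> 'd::ab_group_add \<Rightarrow> 'd) \<Rightarrow>
   ('a \<Rightarrow> 'b \<Rightarrow> 'c \<Rightarrow> 'd) \<Rightarrow> bool" where
  "trilinear_map sa sb sc sd f \<longleftrightarrow>
     (\<forall>y z. Vector_Spaces.linear sa sd (\<lambda>x. f x y z)) \<and>
     (\<forall>x z. Vector_Spaces.linear sb sd (\<lambda>y. f x y z)) \<and>
     (\<forall>x y. Vector_Spaces.linear sc sd (f x y))"

locale lie_yamaguti_algebra = vector_space scale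
  for scale :: "'k::field_char_0 \<Rightarrow> 'g::ab_group_add \<Rightarrow> 'g" +
  fixes br :: "'g \<Rightarrow> 'g \<Rightarrow> 'g"
    and tr :: "'g \<Rightarrow> 'g \<Rightarrow> 'g \<Rightarrow> 'g"
  assumes br_bilinear: "bilinear_map scale scale scale br"
    and br_alternating: "br x x = 0"
    and tr_trilinear: "trilinear_map scale scale scale scale tr"
    and tr_alternating: "tr x x z = 0"
    and cyclic_br_tr:
      "br (br x y) z + br (br y z) x + br (br z x) y + tr x y z + tr y z x + tr z x y = 0"
    and cyclic_tr_br: "tr (br x y) z w + tr (br y z) x w + tr (br z x) y w = 0"
    and tr_derivation_br: "tr x y (br z w) = br (tr x y z) w + br z (tr x y w)"
    and tr_derivation_tr:
      "tr x y (tr z w t) = tr (tr x y z) w t + tr z (tr x y w) t + tr z w (tr x y t)"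

definition rep_D ::
  "('g \<Rightarrow> 'g \<Rightarrow> 'g) \<Rightarrow> ('g \<Rightarrow> 'v \<Rightarrow> 'v) \<Rightarrow> ('g \<Rightarrow> 'g \<Rightarrow> 'v \<Rightarrow> 'v) \<Rightarrow>
   'g \<Rightarrow> 'g \<Rightarrow> 'v \<Rightarrow> 'v::ab_group_add" where
  "rep_D br \<rho> \<mu> x y v =
     \<mu> y x v - \<mu> x y v + (\<rho> x (\<rho> y v) - \<rho> y (\<rho> x v)) - \<rho> (br x y) v"

text \<open>
  The assumptions \<open>rho_bilinear\<close> and \<open>mu_trilinear\<close> say both that \<open>\<rho>\<close> and \<open>\<mu>\<close> take values in
  \<open>gl(V)\<close> and that they are linear, respectively bilinear, on the algebra.
\<close>

locale lieyrep_pair =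
  lie_yamaguti_algebra scale br tr + V: vector_space scaleV
  for scale :: "'k::field_char_0 \<Rightarrow> 'g::ab_group_add \<Rightarrow> 'g"
    and br :: "'g \<Rightarrow> 'g \<Rightarrow> 'g"
    and tr :: "'g \<Rightarrow> 'g \<Rightarrow> 'g \<Rightarrow> 'g"
    and scaleV :: "'k \<Rightarrow> 'v::ab_group_add \<Rightarrow> 'v" +
  fixes \<rho> :: "'g \<Rightarrow> 'v \<Rightarrow> 'v"
    and \<mu> :: "'g \<Rightarrow> 'g \<Rightarrow> 'v \<Rightarrow> 'v"
  assumes rho_bilinear: "bilinear_map scale scaleV scaleV \<rho>"
    and mu_trilinear: "trilinear_map scale scale scaleV scaleV \<mu>"
    and mu_br_left: "\<mu> (br x y) z v - \<mu> x z (\<rho> y v) + \<mu> y z (\<rho> x v) = 0"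
    and mu_br_right: "\<mu> x (br y z) v - \<rho> y (\<mu> x z v) + \<rho> z (\<mu> x y v) = 0"
    and rho_tr: "\<rho> (tr x y z) v = rep_D br \<rho> \<mu> x y (\<rho> z v) - \<rho> z (rep_D br \<rho> \<mu> x y v)"
    and mu_mu: "\<mu> z w (\<mu> x y v) - \<mu> y w (\<mu> x z v) - \<mu> x (tr y z w) v
                  + rep_D br \<rho> \<mu> y z (\<mu> x w v) = 0"
    and mu_tr: "\<mu> (tr x y z) w v + \<mu> z (tr x y w) v
                  = rep_D br \<rho> \<mu> x y (\<mu> z w v) - \<mu> z w (rep_D br \<rho> \<mu> x y v)"

definition deformed_br ::
  "('a \<Rightarrow> 'a) \<Rightarrow> ('a \<Rightarrow> 'a \<Rightarrow> 'a) \<Rightarrow> 'a \<Rightarrow> 'a \<Rightarrow> 'a::ab_group_add" where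
  "deformed_br N br x y = br (N x) y + br x (N y) - N (br x y)"

definition deformed_tr ::
  "('a \<Rightarrow> 'a) \<Rightarrow> ('a \<Rightarrow> 'a \<Rightarrow> 'a \<Rightarrow> 'a) \<Rightarrow> 'a \<Rightarrow> 'a \<Rightarrow> 'a \<Rightarrow> 'a::ab_group_add" where
  "deformed_tr N tr x y z =
     tr (N x) (N y) z + tr x (N y) (N z) + tr (N x) y (N z)
     - N (tr (N x) y z + tr x (N y) z + tr x y (N z)) + N (N (tr x y z))"

locale nijenhuis_operator = lie_yamaguti_algebra scale br tr
  for scale :: "'k::field_char_0 \<Rightarrow> 'g::ab_group_add \<Rightarrow> 'g"
    and br :: "'g \<Rightarrow> 'g \<Rightarrow> 'g"
    and tr :: "'g \<Rightarrow> 'g \<Rightarrow> 'g \<Rightarrow> 'g" +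
  fixes N :: "'g \<Rightarrow> 'g"
  assumes N_linear: "Vector_Spaces.linear scale scale N"
    and N_br: "br (N x) (N y) = N (deformed_br N br x y)"
    and N_tr: "tr (N x) (N y) (N z) = N (deformed_tr N tr x y z)"

definition hat_rho ::
  "('g \<Rightarrow> 'g) \<Rightarrow> ('v \<Rightarrow> 'v) \<Rightarrow> ('g \<Rightarrow> 'v \<Rightarrow> 'v) \<Rightarrow> 'g \<Rightarrow> 'v \<Rightarrow> 'v::ab_group_add" where
  "hat_rho N S \<rho> x v = \<rho> (N x) v + \<rho> x (S v) - S (\<rho> x v)"

definition hat_mu ::
  "('g \<Rightarrow> 'g) \<Rightarrow> ('v \<Rightarrow> 'v) \<Rightarrow> ('g \<Rightarrow> 'g \<Rightarrow> 'v \<Rightarrow> 'v) \<Rightarrow>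
   'g \<Rightarrow> 'g \<Rightarrow> 'v \<Rightarrow> 'v::ab_group_add" where
  "hat_mu N S \<mu> x y v =
     \<mu> (N x) y (S v) + \<mu> x (N y) (S v) + \<mu> (N x) (N y) v
     - S (\<mu> (N x) y v + \<mu> x (N y) v + \<mu> x y (S v)) + S (S (\<mu> x y v))"

locale nijenhuis_structure =
  lieyrep_pair scale br tr scaleV \<rho> \<mu> + nijenhuis_operator scale br tr N
  for scale :: "'k::field_char_0 \<Rightarrow> 'g::ab_group_add \<Rightarrow> 'g"
    and br :: "'g \<Rightarrow> 'g \<Rightarrow> 'g"
    and tr :: "'g \<Rightarrow> 'g \<Rightarrow> 'g \<Rightarrow> 'g"
    and scaleV :: "'k \<Rightarrow> 'v::ab_group_add \<Rightarrow> 'v"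
    and \<rho> :: "'g \<Rightarrow> 'v \<Rightarrow> 'v"
    and \<mu> :: "'g \<Rightarrow> 'g \<Rightarrow> 'v \<Rightarrow> 'v"
    and N :: "'g \<Rightarrow> 'g" +
  fixes S :: "'v \<Rightarrow> 'v"
  assumes S_linear: "Vector_Spaces.linear scaleV scaleV S"
    and rho_N_S: "\<rho> (N x) (S v) = S (hat_rho N S \<rho> x v)"
    and mu_N_S: "\<mu> (N x) (N y) (S v) = S (hat_mu N S \<mu> x y v)"

definition rb_br ::
  "('g \<Rightarrow> 'v \<Rightarrow> 'v) \<Rightarrow> ('v \<Rightarrow> 'g) \<Rightarrow> 'v \<Rightarrow> 'v \<Rightarrow> 'v::ab_group_add" where
  "rb_br \<rho> T u v = \<rho> (T u) v - \<rho> (T v) u"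

definition rb_tr ::
  "('g \<Rightarrow> 'g \<Rightarrow> 'g) \<Rightarrow> ('g \<Rightarrow> 'v \<Rightarrow> 'v) \<Rightarrow> ('g \<Rightarrow> 'g \<Rightarrow> 'v \<Rightarrow> 'v) \<Rightarrow> ('v \<Rightarrow> 'g) \<Rightarrow>
   'v \<Rightarrow> 'v \<Rightarrow> 'v \<Rightarrow> 'v::ab_group_add" where
  "rb_tr br \<rho> \<mu> T u v w =
     rep_D br \<rho> \<mu> (T u) (T v) w + \<mu> (T v) (T w) u - \<mu> (T u) (T w) v"

locale relative_rota_baxter = lieyrep_pair scale br tr scaleV \<rho> \<mu>
  for scale :: "'k::field_char_0 \<Rightarrow> 'g::ab_group_add \<Rightarrow> 'g"
    and br :: "'g \<Rightarrow> 'g \<Rightarrow> 'g"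
    and tr :: "'g \<Rightarrow> 'g \<Rightarrow> 'g \<Rightarrow> 'g"
    and scaleV :: "'k \<Rightarrow> 'v::ab_group_add \<Rightarrow> 'v"
    and \<rho> :: "'g \<Rightarrow> 'v \<Rightarrow> 'v"
    and \<mu> :: "'g \<Rightarrow> 'g \<Rightarrow> 'v \<Rightarrow> 'v" +
  fixes T :: "'v \<Rightarrow> 'g"
  assumes T_linear: "Vector_Spaces.linear scaleV scale T"
    and T_br: "br (T u) (T v) = T (rb_br \<rho> T u v)"
    and T_tr: "tr (T u) (T v) (T w) = T (rb_tr br \<rho> \<mu> T u v w)"

text \<open>
  The deformations of the two operations on \<open>V\<close> by \<open>S\<close> have the same shape as those of the
  algebra operations by \<open>N\<close>, so \<open>deformed_br\<close> and \<open>deformed_tr\<close> are used for both.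
\<close>

locale relative_rota_baxter_nijenhuis =
  relative_rota_baxter scale br tr scaleV \<rho> \<mu> T +
  nijenhuis_structure scale br tr scaleV \<rho> \<mu> N S
  for scale :: "'k::field_char_0 \<Rightarrow> 'g::ab_group_add \<Rightarrow> 'g"
    and br :: "'g \<Rightarrow> 'g \<Rightarrow> 'g"
    and tr :: "'g \<Rightarrow> 'g \<Rightarrow> 'g \<Rightarrow> 'g"
    and scaleV :: "'k \<Rightarrow> 'v::ab_group_add \<Rightarrow> 'v"
    and \<rho> :: "'g \<Rightarrow> 'v \<Rightarrow> 'v"
    and \<mu> :: "'g \<Rightarrow> 'g \<Rightarrow> 'v \<Rightarrow> 'v"
    and T :: "'v \<Rightarrow> 'g"
    and S :: "'v \<Rightarrow> 'v"
    and N :: "'g \<Rightarrow> 'g" +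
  assumes N_T: "N \<circ> T = T \<circ> S"
    and br_S_eq: "deformed_br S (rb_br \<rho> T) u v = rb_br \<rho> (N \<circ> T) u v"
    and tr_S_eq: "deformed_tr S (rb_tr br \<rho> \<mu> T) u v w = rb_tr br \<rho> \<mu> (N \<circ> T) u v w"

end

theory Submission
  imports Defs "HOL-Library.Product_Plus"
begin

text \<open>
  Everything takes place in the semidirect product \<open>\<gg> \<times> V\<close>. A linear map \<open>T : V \<rightarrow> \<gg>\<close> is a relative
  Rota-Baxter operator precisely when its graph is closed under the two operations of that product,
  and those operations then restrict to the graph as the operations that \<open>T\<close> induces on \<open>V\<close>. A
  Nijenhuis structure \<open>(N, S)\<close> says that \<open>N \<times> S\<close> is a Nijenhuis operator on the semidirect product,
  and deforming the product by \<open>N \<times> S\<close> gives the semidirect product of the deformed algebra with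
  the deformed representation (\<open>deformed_semidirect_br\<close>, \<open>deformed_semidirect_tr\<close>).

  Since \<open>N \<circ> T = T \<circ> S\<close>, the operator \<open>N \<times> S\<close> maps the graph of \<open>T\<close> into itself, where it acts as
  \<open>S\<close>. The graph therefore stays closed under the deformed operations, which restrict to it as the
  \<open>S\<close>-deformations of the operations on \<open>V\<close>: this is the first claim. The second follows by applying
  \<open>N\<close>: the compatibility conditions identify the \<open>S\<close>-deformed operations on \<open>V\<close> with those induced
  by \<open>N \<circ> T\<close>, and the Nijenhuis identities turn \<open>N\<close> of a deformed product in \<open>\<gg>\<close> into a product of
  images under \<open>N\<close>.

  The first claim includes that the deformed algebra is a Lie-Yamaguti algebra and that the hatted
  maps represent it. As a representation is the same thing as a semidirect product that satisfies the
  Lie-Yamaguti identities (\<open>lie_yamaguti_algebra_semidirect\<close>, \<open>lieyrep_pair_of_semidirect\<close>), both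
  follow from one theorem about a single Nijenhuis operator, \<open>lie_yamaguti_algebra_deformed\<close>, used
  for \<open>N\<close> and for \<open>N \<times> S\<close>. It is proved by putting the deformed operations at the top of a
  polynomial family of operations that \<open>1 + t N\<close> maps homomorphically to the original ones.
\<close>

section \<open>Linear maps\<close>

lemma bilinear_map_iff:
  "bilinear_map sa sb sc f \<longleftrightarrow> vector_space sa \<and> vector_space sb \<and> vector_space sc \<and>
     (\<forall>x x' y. f (x + x') y = f x y + f x' y) \<and> (\<forall>x y y'. f x (y + y') = f x y + f x y') \<and>
     (\<forall>k x y. f (sa k x) y = sc k (f x y)) \<and> (\<forall>k x y. f x (sb k y) = sc k (f x y))"
  unfolding bilinear_map_def Vector_Spaces.linear_iff by blast

lemma trilinear_map_iff:
  "trilinear_map sa sb sc sd f \<longleftrightarrow>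
     vector_space sa \<and> vector_space sb \<and> vector_space sc \<and> vector_space sd \<and>
     (\<forall>x x' y z. f (x + x') y z = f x y z + f x' y z) \<and>
     (\<forall>x y y' z. f x (y + y') z = f x y z + f x y' z) \<and>
     (\<forall>x y z z'. f x y (z + z') = f x y z + f x y z') \<and>
     (\<forall>k x y z. f (sa k x) y z = sd k (f x y z)) \<and>
     (\<forall>k x y z. f x (sb k y) z = sd k (f x y z)) \<and>
     (\<forall>k x y z. f x y (sc k z) = sd k (f x y z))"
  unfolding trilinear_map_def Vector_Spaces.linear_iff by auto

lemma linear_map_simps:
  assumes "Vector_Spaces.linear sa sb f"
  shows "f (x + y) = f x + f y" "f (x - y) = f x - f y" "f (- x) = - f x" "f 0 = 0"
    "f (sa k x) = sb k (f x)"
proof -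
  interpret Vector_Spaces.linear sa sb f by fact
  show "f (x + y) = f x + f y" "f (x - y) = f x - f y" "f (- x) = - f x" "f 0 = 0"
    "f (sa k x) = sb k (f x)"
    by (simp_all add: add diff neg scale)
qed

lemma bilinear_map_simps:
  assumes "bilinear_map sa sb sc f"
  shows "f (x + x') y = f x y + f x' y" "f (x - x') y = f x y - f x' y" "f (- x) y = - f x y"
    "f 0 y = 0" "f (sa k x) y = sc k (f x y)"
    "f x (y + y') = f x y + f x y'" "f x (y - y') = f x y - f x y'" "f x (- y) = - f x y"
    "f x 0 = 0" "f x (sb k y) = sc k (f x y)"
proof -
  have 1: "Vector_Spaces.linear sa sc (\<lambda>x. f x y)" and 2: "Vector_Spaces.linear sb sc (f x)" for x y
    using assms by (simp_all add: bilinear_map_def)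
  show "f (x + x') y = f x y + f x' y" "f (x - x') y = f x y - f x' y" "f (- x) y = - f x y"
    "f 0 y = 0" "f (sa k x) y = sc k (f x y)"
    by (fact linear_map_simps[OF 1])+
  show "f x (y + y') = f x y + f x y'" "f x (y - y') = f x y - f x y'" "f x (- y) = - f x y"
    "f x 0 = 0" "f x (sb k y) = sc k (f x y)"
    by (fact linear_map_simps[OF 2])+
qed

lemma trilinear_map_simps:
  assumes "trilinear_map sa sb sc sd f"
  shows "f (x + x') y z = f x y z + f x' y z" "f (x - x') y z = f x y z - f x' y z"
    "f (- x) y z = - f x y z" "f 0 y z = 0" "f (sa k x) y z = sd k (f x y z)"
    "f x (y + y') z = f x y z + f x y' z" "f x (y - y') z = f x y z - f x y' z"
    "f x (- y) z = - f x y z" "f x 0 z = 0" "f x (sb k y) z = sd k (f x y z)"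
    "f x y (z + z') = f x y z + f x y z'" "f x y (z - z') = f x y z - f x y z'"
    "f x y (- z) = - f x y z" "f x y 0 = 0" "f x y (sc k z) = sd k (f x y z)"
proof -
  have 1: "Vector_Spaces.linear sa sd (\<lambda>x. f x y z)"
    and 2: "Vector_Spaces.linear sb sd (\<lambda>y. f x y z)"
    and 3: "Vector_Spaces.linear sc sd (f x y)" for x y z
    using assms by (simp_all add: trilinear_map_def)
  show "f (x + x') y z = f x y z + f x' y z" "f (x - x') y z = f x y z - f x' y z"
    "f (- x) y z = - f x y z" "f 0 y z = 0" "f (sa k x) y z = sd k (f x y z)"
    by (fact linear_map_simps[OF 1])+
  show "f x (y + y') z = f x y z + f x y' z" "f x (y - y') z = f x y z - f x y' z"
    "f x (- y) z = - f x y z" "f x 0 z = 0" "f x (sb k y) z = sd k (f x y z)"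
    by (fact linear_map_simps[OF 2])+
  show "f x y (z + z') = f x y z + f x y z'" "f x y (z - z') = f x y z - f x y z'"
    "f x y (- z) = - f x y z" "f x y 0 = 0" "f x y (sc k z) = sd k (f x y z)"
    by (fact linear_map_simps[OF 3])+
qed

context lie_yamaguti_algebra
begin

lemmas br_simps = bilinear_map_simps[OF br_bilinear]
lemmas tr_simps = trilinear_map_simps[OF tr_trilinear]

lemma br_skew: "br x y = - br y x"
  using br_alternating[of "x + y"] br_alternating[of x] br_alternating[of y]
  by (simp add: br_simps eq_neg_iff_add_eq_0 add.commute)

lemma tr_skew: "tr x y z = - tr y x z"
  using tr_alternating[of "x + y" z] tr_alternating[of x z] tr_alternating[of y z]
  by (simp add: tr_simps eq_neg_iff_add_eq_0 add.commute)

end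

section \<open>Polynomial families of vectors\<close>

text \<open>
  The degree \<open>d\<close> is only a bound, and the coefficient \<open>a\<close> at \<open>d\<close> may vanish. Fixing the degree
  formally makes coefficients at \<open>d\<close> additive, so that the top coefficient of an expression
  can be read off from its shape.
\<close>

definition has_top_coeff ::
  "('a::comm_semiring_1 \<Rightarrow> 'b \<Rightarrow> 'b) \<Rightarrow> nat \<Rightarrow> ('a \<Rightarrow> 'b) \<Rightarrow> 'b::comm_monoid_add \<Rightarrow> bool" where
  "has_top_coeff scale d f a \<longleftrightarrow>
     (\<exists>q. q d = a \<and> (\<forall>t. f t = (\<Sum>i\<le>d. scale (t ^ i) (q i))))"

context vector_space
begin

lemma has_top_coeff_const: "has_top_coeff scale 0 (\<lambda>t. x) x"
  unfolding has_top_coeff_def by auto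

lemma has_top_coeff_add:
  assumes "has_top_coeff scale d f a" "has_top_coeff scale d g b"
  shows "has_top_coeff scale d (\<lambda>t. f t + g t) (a + b)"
proof -
  from assms obtain p q where
    "p d = a" "\<And>t. f t = (\<Sum>i\<le>d. scale (t ^ i) (p i))"
    "q d = b" "\<And>t. g t = (\<Sum>i\<le>d. scale (t ^ i) (q i))"
    unfolding has_top_coeff_def by blast
  then show ?thesis
    unfolding has_top_coeff_def
    by (intro exI[of _ "\<lambda>i. p i + q i"]) (simp add: scale_right_distrib sum.distrib)
qed

lemma has_top_coeff_linear:
  assumes L: "Vector_Spaces.linear scale scale L" and f: "has_top_coeff scale d f a"
  shows "has_top_coeff scale d (\<lambda>t. L (f t)) (L a)"
proof -
  interpret L: Vector_Spaces.linear scale scale L by fact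
  from f obtain p where "p d = a" "\<And>t. f t = (\<Sum>i\<le>d. scale (t ^ i) (p i))"
    unfolding has_top_coeff_def by blast
  then show ?thesis
    unfolding has_top_coeff_def
    by (intro exI[of _ "\<lambda>i. L (p i)"]) (simp add: L.sum L.scale)
qed

lemma has_top_coeff_diff:
  assumes "has_top_coeff scale d f a" "has_top_coeff scale d g b"
  shows "has_top_coeff scale d (\<lambda>t. f t - g t) (a - b)"
  using has_top_coeff_add[OF assms(1) has_top_coeff_linear[OF _ assms(2), of uminus]]
  by (simp add: linear_uminus)

lemma has_top_coeff_shift:
  assumes "has_top_coeff scale d f a"
  shows "has_top_coeff scale (Suc d) (\<lambda>t. scale t (f t)) a"
proof -
  from assms obtain p where "p d = a" "\<And>t. f t = (\<Sum>i\<le>d. scale (t ^ i) (p i))"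
    unfolding has_top_coeff_def by blast
  then show ?thesis
    unfolding has_top_coeff_def
    by (intro exI[of _ "case_nat 0 p"])
      (simp add: sum.atMost_Suc_shift scale_sum_right del: sum.atMost_Suc)
qed

lemma has_top_coeff_raise:
  assumes "has_top_coeff scale d f a"
  shows "has_top_coeff scale (Suc d) f 0"
proof -
  from assms obtain p where "\<And>t. f t = (\<Sum>i\<le>d. scale (t ^ i) (p i))"
    unfolding has_top_coeff_def by blast
  then show ?thesis
    unfolding has_top_coeff_def
    by (intro exI[of _ "\<lambda>i. if i \<le> d then p i else 0"]) simp
qed

text \<open>
  A family of linear maps that is itself polynomial in \<open>t\<close> raises the degree by its own, and the top
  coefficients compose. Iterated brackets of polynomial families of operations are
  treated one slot at a time in this way.
\<close>

lemma has_top_coeff_linear_family: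
  assumes "Vector_Spaces.linear scale scale L0" "Vector_Spaces.linear scale scale L1"
    and "has_top_coeff scale d f a"
  shows "has_top_coeff scale (Suc d) (\<lambda>t. L0 (f t) + scale t (L1 (f t))) (L1 a)"
  using has_top_coeff_add[OF has_top_coeff_raise[OF has_top_coeff_linear[OF assms(1,3)]]
      has_top_coeff_shift[OF has_top_coeff_linear[OF assms(2,3)]]] by simp

lemma has_top_coeff_quadratic_family:
  assumes L: "Vector_Spaces.linear scale scale L0" "Vector_Spaces.linear scale scale L1"
      "Vector_Spaces.linear scale scale L2"
    and f: "has_top_coeff scale d f a"
  shows "has_top_coeff scale (Suc (Suc d))
    (\<lambda>t. L0 (f t) + scale t (L1 (f t)) + scale (t ^ 2) (L2 (f t))) (L2 a)"
  using has_top_coeff_add[OF has_top_coeff_raise[OF has_top_coeff_linear_family[OF L(1,2) f]]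
      has_top_coeff_shift[OF has_top_coeff_shift[OF has_top_coeff_linear[OF L(3) f]]]]
  by (simp add: power2_eq_square)

end

text \<open>
  Over a field of characteristic \<open>0\<close> a polynomial function determines its coefficients: the combination \<open>f (2 t) - 2 ^ n f (t)\<close> kills the term of degree \<open>n\<close> and
  multiplies each lower coefficient by a nonzero scalar, which gives an induction on the degree.
\<close>

lemma polynomial_family_eq_0:
  fixes scale :: "'k::field_char_0 \<Rightarrow> 'b::ab_group_add \<Rightarrow> 'b"
  assumes "vector_space scale"
    and "\<And>t. (\<Sum>i\<le>n. scale (t ^ i) (q i)) = 0" and "i \<le> n"
  shows "q i = 0"
  using assms(2,3)
proof (induction n arbitrary: q i)
  case 0
  interpret vector_space scale by fact
  from 0(1)[of 1] 0(2) show ?case by simp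
next
  case (Suc n)
  interpret vector_space scale by fact
  let ?p = "\<lambda>i. scale (2 ^ i - 2 ^ Suc n) (q i)"
  have "(\<Sum>i\<le>n. scale (t ^ i) (?p i)) = 0" for t
  proof -
    have "(\<Sum>i\<le>n. scale (t ^ i) (?p i)) = (\<Sum>i\<le>Suc n. scale (t ^ i) (?p i))"
      by simp
    also have "\<dots> = (\<Sum>i\<le>Suc n. scale ((2 * t) ^ i) (q i))
        - scale (2 ^ Suc n) (\<Sum>i\<le>Suc n. scale (t ^ i) (q i))"
      unfolding scale_sum_right sum_subtractf[symmetric]
      by (intro sum.cong refl) (simp add: algebra_simps power_mult_distrib)
    finally show ?thesis by (simp only: Suc.prems(1) scale_zero_right diff_0_right)
  qed
  then have p: "?p i = 0" if "i \<le> n" for i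
    using Suc.IH[of ?p] that by blast
  have low: "q i = 0" if "i \<le> n" for i
  proof -
    have "(2::'k) ^ Suc n - 2 ^ i = of_nat (2 ^ Suc n - 2 ^ i)"
      using of_nat_diff[of "2 ^ i" "2 ^ Suc n :: nat", where 'a = 'k] that
      by (simp add: power_increasing del: power_Suc)
    moreover have "(2::nat) ^ Suc n - 2 ^ i > 0"
      using that by (simp add: power_strict_increasing del: power_Suc)
    ultimately have "(2::'k) ^ i - 2 ^ Suc n \<noteq> 0"
      by (metis of_nat_eq_0_iff less_irrefl right_minus_eq)
    then show ?thesis using p[OF that] by simp
  qed
  moreover have "q (Suc n) = 0"
    using Suc.prems(1)[of 1] low by simp
  ultimately show ?case using Suc.prems(2) by (cases "i = Suc n") auto
qed

section \<open>The deformed algebra of a Nijenhuis operator\<close>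

context nijenhuis_operator
begin

lemmas N_simps = linear_map_simps[OF N_linear]

text \<open>
  With \<open>shear t = 1 + t N\<close>, the Nijenhuis identities say that there are polynomial families of
  operations, with the original ones as constant terms and the deformed ones as top coefficients,
  that \<open>shear t\<close> carries to the original operations for every \<open>t\<close>. The coefficient
  \<open>middle_tr\<close> of \<open>t\<close> in the ternary family is forced by comparing the terms that are linear in \<open>t\<close>.
\<close>

definition shear :: "'k \<Rightarrow> 'g \<Rightarrow> 'g" where
  "shear t x = x + scale t (N x)"

definition pencil_br :: "'k \<Rightarrow> 'g \<Rightarrow> 'g \<Rightarrow> 'g" where
  "pencil_br t x y = br x y + scale t (deformed_br N br x y)"

definition middle_tr :: "'g \<Rightarrow> 'g \<Rightarrow> 'g \<Rightarrow> 'g" where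
  "middle_tr x y z = tr (N x) y z + tr x (N y) z + tr x y (N z) - N (tr x y z)"

definition pencil_tr :: "'k \<Rightarrow> 'g \<Rightarrow> 'g \<Rightarrow> 'g \<Rightarrow> 'g" where
  "pencil_tr t x y z =
     tr x y z + scale t (middle_tr x y z) + scale (t ^ 2) (deformed_tr N tr x y z)"

lemma shear_pencil_br: "shear t (pencil_br t x y) = br (shear t x) (shear t y)"
  unfolding shear_def pencil_br_def
  by (simp add: N_simps br_simps N_br[symmetric])
    (simp add: deformed_br_def N_simps algebra_simps)

lemma shear_pencil_tr:
  "shear t (pencil_tr t x y z) = tr (shear t x) (shear t y) (shear t z)"
  unfolding shear_def pencil_tr_def
  by (simp add: N_simps tr_simps N_tr[symmetric])
    (simp add: middle_tr_def deformed_tr_def N_simps algebra_simps power2_eq_square)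

text \<open>
  As a power series in \<open>t\<close>, \<open>1 + t N\<close> is invertible, so it has no polynomial in its kernel, even
  where some \<open>1 + t N\<close> fails to be injective. Concretely, the coefficients satisfy \<open>q 0 = 0\<close> and
  \<open>q (i + 1) = - N (q i)\<close>.
\<close>

lemma top_coeff_eq_0:
  assumes f: "has_top_coeff scale d f a" and shear_f: "\<And>t. shear t (f t) = 0"
  shows "a = 0"
proof -
  interpret N: Vector_Spaces.linear scale scale N by (fact N_linear)
  from f obtain q where q: "q d = a" "\<And>t. f t = (\<Sum>i\<le>d. scale (t ^ i) (q i))"
    unfolding has_top_coeff_def by blast
  define r where "r = (\<lambda>i. (if i \<le> d then q i else 0) + (case i of 0 \<Rightarrow> 0 | Suc j \<Rightarrow> N (q j)))"
  \<comment> \<open>the coefficients of \<open>shear t (f t)\<close>\<close>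
  have "(\<Sum>i\<le>Suc d. scale (t ^ i) (r i)) = 0" for t
  proof -
    have "(\<Sum>i\<le>Suc d. scale (t ^ i) (case i of 0 \<Rightarrow> 0 | Suc j \<Rightarrow> N (q j))) = scale t (N (f t))"
      by (simp add: sum.atMost_Suc_shift q(2) N.sum N.scale scale_sum_right del: sum.atMost_Suc)
    moreover have "(\<Sum>i\<le>Suc d. scale (t ^ i) (if i \<le> d then q i else 0)) = f t"
      by (simp add: q(2))
    ultimately have "(\<Sum>i\<le>Suc d. scale (t ^ i) (r i)) = shear t (f t)"
      unfolding r_def shear_def scale_right_distrib sum.distrib by simp
    then show ?thesis by (simp add: shear_f)
  qed
  then have r0: "r i = 0" if "i \<le> d" for i
    using that polynomial_family_eq_0[OF vector_space_axioms, where n = "Suc d" and q = r and i = i] by simp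
  have "q i = 0" if "i \<le> d" for i
    using that
  proof (induction i)
    case 0 then show ?case using r0[of 0] by (simp add: r_def)
  next
    case (Suc i) then show ?case using r0[of "Suc i"] by (simp add: r_def N.zero)
  qed
  then show ?thesis using q(1) by blast
qed

lemma deformed_br_bilinear: "bilinear_map scale scale scale (deformed_br N br)"
  by (auto simp: bilinear_map_iff deformed_br_def N_simps br_simps algebra_simps)
    unfold_locales

lemma middle_tr_trilinear: "trilinear_map scale scale scale scale middle_tr"
  by (auto simp: trilinear_map_iff middle_tr_def N_simps tr_simps algebra_simps)
    unfold_locales

lemma deformed_tr_trilinear: "trilinear_map scale scale scale scale (deformed_tr N tr)"
  by (auto simp: trilinear_map_iff deformed_tr_def N_simps tr_simps algebra_simps)
    unfold_locales

lemma has_top_coeff_pencil_br: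
  assumes "has_top_coeff scale d f a"
  shows "has_top_coeff scale (Suc d) (\<lambda>t. pencil_br t (f t) y) (deformed_br N br a y)"
    and "has_top_coeff scale (Suc d) (\<lambda>t. pencil_br t x (f t)) (deformed_br N br x a)"
  using has_top_coeff_linear_family[of "\<lambda>a. br a y" "\<lambda>a. deformed_br N br a y", OF _ _ assms]
    has_top_coeff_linear_family[of "br x" "deformed_br N br x", OF _ _ assms]
    br_bilinear deformed_br_bilinear
  by (simp_all add: pencil_br_def bilinear_map_def)

lemma has_top_coeff_pencil_tr:
  assumes "has_top_coeff scale d f a"
  shows "has_top_coeff scale (Suc (Suc d)) (\<lambda>t. pencil_tr t (f t) y z) (deformed_tr N tr a y z)"
    and "has_top_coeff scale (Suc (Suc d)) (\<lambda>t. pencil_tr t x (f t) z) (deformed_tr N tr x a z)"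
    and "has_top_coeff scale (Suc (Suc d)) (\<lambda>t. pencil_tr t x y (f t)) (deformed_tr N tr x y a)"
  using has_top_coeff_quadratic_family[of "\<lambda>a. tr a y z" "\<lambda>a. middle_tr a y z"
      "\<lambda>a. deformed_tr N tr a y z", OF _ _ _ assms]
    has_top_coeff_quadratic_family[of "\<lambda>a. tr x a z" "\<lambda>a. middle_tr x a z"
      "\<lambda>a. deformed_tr N tr x a z", OF _ _ _ assms]
    has_top_coeff_quadratic_family[of "tr x y" "middle_tr x y" "deformed_tr N tr x y", OF _ _ _ assms]
    tr_trilinear middle_tr_trilinear deformed_tr_trilinear
  by (simp_all add: pencil_tr_def trilinear_map_def)

lemma shear_simps:
  "shear t (x + y) = shear t x + shear t y" "shear t (x - y) = shear t x - shear t y"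
  by (simp_all add: shear_def N_simps algebra_simps)

lemmas has_top_coeff_intros =
  has_top_coeff_add has_top_coeff_diff
  has_top_coeff_pencil_br has_top_coeff_pencil_br[OF has_top_coeff_const]
  has_top_coeff_pencil_tr has_top_coeff_pencil_tr[OF has_top_coeff_const]

text \<open>
  Each identity of degree \<open>d\<close> in the pencil operations is carried by \<open>shear t\<close> to the same identity
  for the original operations, which holds. Hence all its coefficients vanish, and the one at \<open>t ^ d\<close>
  is the identity for the deformed operations: the binary bracket counts for degree 1
  and the ternary one for degree 2, so that all terms of an identity have the same degree.
\<close>

theorem lie_yamaguti_algebra_deformed:
  "lie_yamaguti_algebra scale (deformed_br N br) (deformed_tr N tr)"
proof
  let ?b = "deformed_br N br" and ?c = "deformed_tr N tr"
  show "bilinear_map scale scale scale ?b" by (rule deformed_br_bilinear)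
  show "trilinear_map scale scale scale scale ?c" by (rule deformed_tr_trilinear)
  show "?b x x = 0" for x
    using br_skew[of "N x" x] by (simp add: deformed_br_def br_alternating N_simps)
  show "?c x x z = 0" for x z
    using tr_skew[of "N x" x] by (simp add: deformed_tr_def tr_alternating N_simps)
  fix x y z w u
  show "?b (?b x y) z + ?b (?b y z) x + ?b (?b z x) y + ?c x y z + ?c y z x + ?c z x y = 0"
  proof (rule top_coeff_eq_0)
    show "has_top_coeff scale (Suc (Suc 0))
      (\<lambda>t. pencil_br t (pencil_br t x y) z + pencil_br t (pencil_br t y z) x
        + pencil_br t (pencil_br t z x) y
        + pencil_tr t x y z + pencil_tr t y z x + pencil_tr t z x y)
      (?b (?b x y) z + ?b (?b y z) x + ?b (?b z x) y + ?c x y z + ?c y z x + ?c z x y)"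
      by (intro has_top_coeff_intros has_top_coeff_const)
  qed (simp add: shear_simps shear_pencil_br shear_pencil_tr cyclic_br_tr)
  show "?c (?b x y) z w + ?c (?b y z) x w + ?c (?b z x) y w = 0"
  proof (rule top_coeff_eq_0)
    show "has_top_coeff scale (Suc (Suc (Suc 0)))
      (\<lambda>t. pencil_tr t (pencil_br t x y) z w + pencil_tr t (pencil_br t y z) x w
        + pencil_tr t (pencil_br t z x) y w)
      (?c (?b x y) z w + ?c (?b y z) x w + ?c (?b z x) y w)"
      by (intro has_top_coeff_intros has_top_coeff_const)
  qed (simp add: shear_simps shear_pencil_br shear_pencil_tr cyclic_tr_br)
  have "?c x y (?b z w) - (?b (?c x y z) w + ?b z (?c x y w)) = 0"
  proof (rule top_coeff_eq_0)
    show "has_top_coeff scale (Suc (Suc (Suc 0)))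
      (\<lambda>t. pencil_tr t x y (pencil_br t z w)
        - (pencil_br t (pencil_tr t x y z) w + pencil_br t z (pencil_tr t x y w)))
      (?c x y (?b z w) - (?b (?c x y z) w + ?b z (?c x y w)))"
      by (intro has_top_coeff_intros has_top_coeff_const)
  qed (simp add: shear_simps shear_pencil_br shear_pencil_tr tr_derivation_br)
  then show "?c x y (?b z w) = ?b (?c x y z) w + ?b z (?c x y w)" by simp
  have "?c x y (?c z w u) - (?c (?c x y z) w u + ?c z (?c x y w) u + ?c z w (?c x y u)) = 0"
  proof (rule top_coeff_eq_0)
    show "has_top_coeff scale (Suc (Suc (Suc (Suc 0))))
      (\<lambda>t. pencil_tr t x y (pencil_tr t z w u)
        - (pencil_tr t (pencil_tr t x y z) w u + pencil_tr t z (pencil_tr t x y w) u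
           + pencil_tr t z w (pencil_tr t x y u)))
      (?c x y (?c z w u) - (?c (?c x y z) w u + ?c z (?c x y w) u + ?c z w (?c x y u)))"
      by (intro has_top_coeff_intros has_top_coeff_const)
  qed (simp add: shear_simps shear_pencil_tr tr_derivation_tr[symmetric])
  then show "?c x y (?c z w u) = ?c (?c x y z) w u + ?c z (?c x y w) u + ?c z w (?c x y u)"
    by simp
qed

end

section \<open>Representations and semidirect products\<close>

definition semidirect_scale :: "('k \<Rightarrow> 'g \<Rightarrow> 'g) \<Rightarrow> ('k \<Rightarrow> 'v \<Rightarrow> 'v) \<Rightarrow> 'k \<Rightarrow> 'g \<times> 'v \<Rightarrow> 'g \<times> 'v" where
  "semidirect_scale s sV k X = (s k (fst X), sV k (snd X))"

definition semidirect_br ::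
  "('g \<Rightarrow> 'g \<Rightarrow> 'g) \<Rightarrow> ('g \<Rightarrow> 'v \<Rightarrow> 'v) \<Rightarrow> 'g \<times> 'v \<Rightarrow> 'g \<times> 'v \<Rightarrow> 'g \<times> 'v::ab_group_add" where
  "semidirect_br br \<rho> X Y = (br (fst X) (fst Y), \<rho> (fst X) (snd Y) - \<rho> (fst Y) (snd X))"

definition semidirect_tr ::
  "('g \<Rightarrow> 'g \<Rightarrow> 'g) \<Rightarrow> ('g \<Rightarrow> 'g \<Rightarrow> 'g \<Rightarrow> 'g) \<Rightarrow> ('g \<Rightarrow> 'v \<Rightarrow> 'v) \<Rightarrow> ('g \<Rightarrow> 'g \<Rightarrow> 'v \<Rightarrow> 'v) \<Rightarrow>
   'g \<times> 'v \<Rightarrow> 'g \<times> 'v \<Rightarrow> 'g \<times> 'v \<Rightarrow> 'g \<times> 'v::ab_group_add" where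
  "semidirect_tr br tr \<rho> \<mu> X Y Z =
     (tr (fst X) (fst Y) (fst Z),
      rep_D br \<rho> \<mu> (fst X) (fst Y) (snd Z)
        + \<mu> (fst Y) (fst Z) (snd X) - \<mu> (fst X) (fst Z) (snd Y))"

context lieyrep_pair
begin

lemmas rho_simps = bilinear_map_simps[OF rho_bilinear]
lemmas mu_simps = trilinear_map_simps[OF mu_trilinear]

lemma rep_D_trilinear: "trilinear_map scale scale scaleV scaleV (rep_D br \<rho> \<mu>)"
  by (auto simp: trilinear_map_iff rep_D_def rho_simps mu_simps br_simps V.scale_right_diff_distrib
        V.scale_right_distrib algebra_simps) unfold_locales

lemmas rep_D_simps = trilinear_map_simps[OF rep_D_trilinear]

lemma rep_D_alternating: "rep_D br \<rho> \<mu> x x v = 0"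
  by (simp add: rep_D_def br_alternating rho_simps)

lemma mu_br_left': "\<mu> (br x y) z v = \<mu> x z (\<rho> y v) - \<mu> y z (\<rho> x v)"
  using mu_br_left[of x y z v] by (simp add: algebra_simps)

lemma mu_br_right': "\<mu> x (br y z) v = \<rho> y (\<mu> x z v) - \<rho> z (\<mu> x y v)"
  using mu_br_right[of x y z v] by (simp add: algebra_simps)

lemma mu_mu': "\<mu> x (tr y z w) v =
    \<mu> z w (\<mu> x y v) - \<mu> y w (\<mu> x z v) + rep_D br \<rho> \<mu> y z (\<mu> x w v)"
  using mu_mu[of z w x y v] by (simp add: algebra_simps)

lemma mu_tr': "\<mu> (tr x y z) w v =
    rep_D br \<rho> \<mu> x y (\<mu> z w v) - \<mu> z w (rep_D br \<rho> \<mu> x y v) - \<mu> z (tr x y w) v"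
  using mu_tr[of x y z w v] by (simp add: algebra_simps)

lemma rho_br: "\<rho> (br x y) v =
    \<mu> y x v - \<mu> x y v + (\<rho> x (\<rho> y v) - \<rho> y (\<rho> x v)) - rep_D br \<rho> \<mu> x y v"
  by (simp add: rep_D_def)

text \<open>
  These two consequences of the representation axioms are the parts of the Lie-Yamaguti identities in
  the semidirect product where \<open>D\<close> acts on the module. In the first, the commutators \<open>[\<rho> [x, y], \<rho> z]\<close>
  are rewritten through the definition of \<open>D x y\<close>: the triple commutators of \<open>\<rho>\<close> cancel by the Jacobi
  identity and the terms in \<open>\<mu>\<close> by its two compatibilities with the bracket, and what is left is \<open>\<rho>\<close>
  applied to the cyclic identity of the algebra. The second holds because \<open>D x y\<close> acts as a
  derivation on \<open>\<mu>\<close>, \<open>\<rho>\<close> and the bracket, the ingredients of \<open>D z w\<close>.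
\<close>

lemma rep_D_cyclic:
  "rep_D br \<rho> \<mu> (br x y) z v + rep_D br \<rho> \<mu> (br y z) x v + rep_D br \<rho> \<mu> (br z x) y v = 0"
proof -
  have "\<rho> (br (br x y) z + br (br y z) x + br (br z x) y + tr x y z + tr y z x + tr z x y) v = 0"
    by (simp only: cyclic_br_tr rho_simps)
  then have "\<rho> (br (br x y) z) v + \<rho> (br (br y z) x) v + \<rho> (br (br z x) y) v =
      - (\<rho> (tr x y z) v + \<rho> (tr y z x) v + \<rho> (tr z x y) v)"
    by (simp add: rho_simps algebra_simps eq_neg_iff_add_eq_0)
  then show ?thesis
    unfolding rep_D_def[of br \<rho> \<mu> "br _ _"] mu_br_left' mu_br_right' rho_br[of x y] rho_br[of y z]
      rho_br[of z x]
    by (simp add: rho_tr rho_simps algebra_simps)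
qed

lemma rep_D_derivation:
  "rep_D br \<rho> \<mu> x y (rep_D br \<rho> \<mu> z w v) =
     rep_D br \<rho> \<mu> (tr x y z) w v + rep_D br \<rho> \<mu> z (tr x y w) v + rep_D br \<rho> \<mu> z w (rep_D br \<rho> \<mu> x y v)"
proof -
  have "\<rho> (br (tr x y z) w) v + \<rho> (br z (tr x y w)) v = \<rho> (tr x y (br z w)) v"
    by (simp add: tr_derivation_br rho_simps)
  then show ?thesis
    unfolding rep_D_def[of br \<rho> \<mu> "tr x y z"] rep_D_def[of br \<rho> \<mu> z]
    by (simp add: rho_tr rep_D_simps rho_simps mu_tr' algebra_simps)
qed

theorem lie_yamaguti_algebra_semidirect:
  "lie_yamaguti_algebra (semidirect_scale scale scaleV) (semidirect_br br \<rho>)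
     (semidirect_tr br tr \<rho> \<mu>)"
proof -
  let ?s = "semidirect_scale scale scaleV"
  let ?b = "semidirect_br br \<rho>" and ?c = "semidirect_tr br tr \<rho> \<mu>"
  interpret P: vector_space ?s
    by unfold_locales (simp_all add: semidirect_scale_def algebra_simps V.scale_right_distrib
        V.scale_left_distrib)
  note defs = semidirect_br_def semidirect_tr_def prod_eq_iff
  show ?thesis
  proof
    show "bilinear_map ?s ?s ?s ?b"
      by (auto simp: bilinear_map_iff defs semidirect_scale_def br_simps rho_simps
          V.scale_right_diff_distrib algebra_simps) unfold_locales
    show "trilinear_map ?s ?s ?s ?s ?c"
      by (auto simp: trilinear_map_iff defs semidirect_scale_def tr_simps mu_simps rep_D_simps
          V.scale_right_diff_distrib V.scale_right_distrib algebra_simps) unfold_locales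
    show "?b X X = 0" for X by (simp add: defs br_alternating)
    show "?c X X Z = 0" for X Z by (simp add: defs tr_alternating rep_D_alternating)
    fix X Y Z W U
    show "?b (?b X Y) Z + ?b (?b Y Z) X + ?b (?b Z X) Y + ?c X Y Z + ?c Y Z X + ?c Z X Y = 0"
      by (simp add: defs cyclic_br_tr) (simp add: rho_br rho_simps)
    show "?c (?b X Y) Z W + ?c (?b Y Z) X W + ?c (?b Z X) Y W = 0"
      using rep_D_cyclic[of "fst X" "fst Y" "fst Z" "snd W"]
      by (simp add: defs cyclic_tr_br) (simp add: mu_simps mu_br_left' algebra_simps)
    show "?c X Y (?b Z W) = ?b (?c X Y Z) W + ?b Z (?c X Y W)"
      by (simp add: defs tr_derivation_br)
        (simp add: mu_br_right' rep_D_simps rho_simps rho_tr algebra_simps)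
    show "?c X Y (?c Z W U) = ?c (?c X Y Z) W U + ?c Z (?c X Y W) U + ?c Z W (?c X Y U)"
      by (simp add: defs tr_derivation_tr[of "fst X" "fst Y" "fst Z" "fst W" "fst U"])
        (simp add: rep_D_derivation[of "fst X" "fst Y" "fst Z" "fst W" "snd U"] rep_D_simps mu_simps mu_tr' mu_mu' algebra_simps)
  qed
qed

end

text \<open>
  The converse direction evaluates the Lie-Yamaguti identities of the product with one argument in
  the module and the others in the algebra. Linearity of \<open>\<rho>\<close> and \<open>\<mu>\<close> is assumed separately: the
  bracket of the product, for instance, is unchanged when the same constant vector is added to all
  values \<open>\<rho> x v\<close>, so its bilinearity alone does not give that of \<open>\<rho>\<close>.
\<close>

lemma lieyrep_pair_of_semidirect:
  assumes "lie_yamaguti_algebra s br tr" "bilinear_map s sV sV \<rho>" "trilinear_map s s sV sV \<mu>"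
    and "lie_yamaguti_algebra (semidirect_scale s sV) (semidirect_br br \<rho>)
      (semidirect_tr br tr \<rho> \<mu>)"
  shows "lieyrep_pair s br tr sV \<rho> \<mu>"
proof -
  interpret lie_yamaguti_algebra s br tr by fact
  interpret V: vector_space sV
    using assms(2) by (simp add: bilinear_map_iff)
  interpret P: lie_yamaguti_algebra "semidirect_scale s sV" "semidirect_br br \<rho>"
      "semidirect_tr br tr \<rho> \<mu>" by fact
  note \<rho>_simps = bilinear_map_simps[OF assms(2)] and \<mu>_simps = trilinear_map_simps[OF assms(3)]
  have D_0: "rep_D br \<rho> \<mu> 0 y v = 0" "rep_D br \<rho> \<mu> x 0 v = 0" "rep_D br \<rho> \<mu> x y 0 = 0" for x y v
    by (simp_all add: rep_D_def \<rho>_simps \<mu>_simps br_simps)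
  note simps = semidirect_br_def semidirect_tr_def prod_eq_iff br_simps tr_simps \<rho>_simps \<mu>_simps D_0
  show ?thesis
  proof
    show "bilinear_map s sV sV \<rho>" "trilinear_map s s sV sV \<mu>" by fact+
    fix x y z w v
    show "\<mu> (br x y) z v - \<mu> x z (\<rho> y v) + \<mu> y z (\<rho> x v) = 0"
      using P.cyclic_tr_br[of "(x, 0)" "(y, 0)" "(0, v)" "(z, 0)"]
      by (simp add: simps) (simp add: algebra_simps)
    show "\<mu> x (br y z) v - \<rho> y (\<mu> x z v) + \<rho> z (\<mu> x y v) = 0"
      using P.tr_derivation_br[of "(0, v)" "(x, 0)" "(y, 0)" "(z, 0)"]
      by (simp add: simps)
    show "\<rho> (tr x y z) v = rep_D br \<rho> \<mu> x y (\<rho> z v) - \<rho> z (rep_D br \<rho> \<mu> x y v)"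
      using P.tr_derivation_br[of "(x, 0)" "(y, 0)" "(z, 0)" "(0, v)"]
      by (simp add: simps)
    show "\<mu> z w (\<mu> x y v) - \<mu> y w (\<mu> x z v) - \<mu> x (tr y z w) v + rep_D br \<rho> \<mu> y z (\<mu> x w v) = 0"
      using P.tr_derivation_tr[of "(0, v)" "(x, 0)" "(y, 0)" "(z, 0)" "(w, 0)"]
      by (simp add: simps)
    show "\<mu> (tr x y z) w v + \<mu> z (tr x y w) v
        = rep_D br \<rho> \<mu> x y (\<mu> z w v) - \<mu> z w (rep_D br \<rho> \<mu> x y v)"
      using P.tr_derivation_tr[of "(x, 0)" "(y, 0)" "(0, v)" "(z, 0)" "(w, 0)"]
      by (simp add: simps)
  qed
qed

section \<open>The deformed representation of a Nijenhuis structure\<close>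

context nijenhuis_structure
begin

lemmas S_simps = linear_map_simps[OF S_linear]

lemma hat_rho_bilinear: "bilinear_map scale scaleV scaleV (hat_rho N S \<rho>)"
  by (auto simp: bilinear_map_iff hat_rho_def N_simps S_simps rho_simps V.scale_right_distrib
      V.scale_right_diff_distrib algebra_simps) unfold_locales

lemma hat_mu_trilinear: "trilinear_map scale scale scaleV scaleV (hat_mu N S \<mu>)"
  by (auto simp: trilinear_map_iff hat_mu_def N_simps S_simps mu_simps V.scale_right_distrib
      V.scale_right_diff_distrib algebra_simps) unfold_locales

text \<open>
  The map \<open>D\<close> of the deformed representation arises from \<open>D\<close> by the formula that defines \<open>hat_mu\<close>
  from \<open>\<mu>\<close>. For the terms of \<open>D\<close> in \<open>\<mu>\<close> this is linearity. For the remaining ones it comes down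
  to moving \<open>S\<close> past \<open>\<rho> (N x)\<close> and to the Nijenhuis identity for the bracket.
\<close>

lemma rep_D_hat:
  "rep_D (deformed_br N br) (hat_rho N S \<rho>) (hat_mu N S \<mu>) x y v = hat_mu N S (rep_D br \<rho> \<mu>) x y v"
proof -
  have \<rho>NS: "\<rho> (N x) (S v) = S (\<rho> (N x) v) + S (\<rho> x (S v)) - S (S (\<rho> x v))" for x v
    by (simp add: rho_N_S hat_rho_def S_simps)
  show ?thesis
    unfolding rep_D_def hat_mu_def hat_rho_def N_br[symmetric]
    by (simp add: N_br[symmetric] deformed_br_def \<rho>NS rho_simps S_simps)
qed

lemma rep_D_N_S: "rep_D br \<rho> \<mu> (N x) (N y) (S v) = S (hat_mu N S (rep_D br \<rho> \<mu>) x y v)"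
  unfolding rep_D_hat[symmetric] unfolding rep_D_def N_br rho_N_S mu_N_S
  by (simp add: S_simps)

lemma deformed_semidirect_br:
  "deformed_br (map_prod N S) (semidirect_br br \<rho>)
     = semidirect_br (deformed_br N br) (hat_rho N S \<rho>)"
  by (intro ext) (simp add: deformed_br_def semidirect_br_def hat_rho_def S_simps prod_eq_iff)

lemma deformed_semidirect_tr:
  "deformed_tr (map_prod N S) (semidirect_tr br tr \<rho> \<mu>)
     = semidirect_tr (deformed_br N br) (deformed_tr N tr) (hat_rho N S \<rho>) (hat_mu N S \<mu>)"
  by (intro ext)
    (simp add: deformed_tr_def semidirect_tr_def rep_D_hat, simp add: hat_mu_def S_simps prod_eq_iff)

lemma nijenhuis_operator_semidirect:
  "nijenhuis_operator (semidirect_scale scale scaleV) (semidirect_br br \<rho>)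
     (semidirect_tr br tr \<rho> \<mu>) (map_prod N S)"
proof -
  interpret P: lie_yamaguti_algebra "semidirect_scale scale scaleV" "semidirect_br br \<rho>"
      "semidirect_tr br tr \<rho> \<mu>"
    by (rule lie_yamaguti_algebra_semidirect)
  show ?thesis
  proof (intro nijenhuis_operator.intro nijenhuis_operator_axioms.intro)
    show "lie_yamaguti_algebra (semidirect_scale scale scaleV) (semidirect_br br \<rho>)
        (semidirect_tr br tr \<rho> \<mu>)"
      by (rule lie_yamaguti_algebra_semidirect)
    show "Vector_Spaces.linear (semidirect_scale scale scaleV) (semidirect_scale scale scaleV)
        (map_prod N S)"
      unfolding Vector_Spaces.linear_iff using P.vector_space_axioms
      by (auto simp: semidirect_scale_def N_simps S_simps)
    fix X Y Z
    show "semidirect_br br \<rho> (map_prod N S X) (map_prod N S Y)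
        = map_prod N S (deformed_br (map_prod N S) (semidirect_br br \<rho>) X Y)"
      unfolding deformed_semidirect_br
      by (simp add: semidirect_br_def N_br rho_N_S S_simps)
    show "semidirect_tr br tr \<rho> \<mu> (map_prod N S X) (map_prod N S Y) (map_prod N S Z)
        = map_prod N S (deformed_tr (map_prod N S) (semidirect_tr br tr \<rho> \<mu>) X Y Z)"
      unfolding deformed_semidirect_tr
      by (simp add: semidirect_tr_def N_tr mu_N_S rep_D_N_S rep_D_hat S_simps)
  qed
qed

theorem lieyrep_pair_deformed:
  "lieyrep_pair scale (deformed_br N br) (deformed_tr N tr) scaleV (hat_rho N S \<rho>) (hat_mu N S \<mu>)"
proof (rule lieyrep_pair_of_semidirect)
  interpret P: nijenhuis_operator "semidirect_scale scale scaleV" "semidirect_br br \<rho>"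
      "semidirect_tr br tr \<rho> \<mu>" "map_prod N S"
    by (rule nijenhuis_operator_semidirect)
  show "lie_yamaguti_algebra (semidirect_scale scale scaleV)
      (semidirect_br (deformed_br N br) (hat_rho N S \<rho>))
      (semidirect_tr (deformed_br N br) (deformed_tr N tr) (hat_rho N S \<rho>) (hat_mu N S \<mu>))"
    using P.lie_yamaguti_algebra_deformed
    unfolding deformed_semidirect_br deformed_semidirect_tr .
qed (fact lie_yamaguti_algebra_deformed hat_rho_bilinear hat_mu_trilinear)+

end

section \<open>Relative Rota-Baxter operators as graphs\<close>

text \<open>
  An additive map that intertwines two operators and two operations also intertwines the deformed
  operations. It is applied to the graph embedding of \<open>V\<close> into \<open>\<gg> \<times> V\<close>.
\<close>

lemma deformed_br_intertwine:
  assumes "\<And>u v. g (u + v) = g u + g v" "\<And>u v. g (u - v) = g u - g v"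
    and "\<And>u. M (g u) = g (S u)" and "\<And>u v. f (g u) (g v) = g (h u v)"
  shows "deformed_br M f (g u) (g v) = g (deformed_br S h u v)"
  by (simp add: deformed_br_def assms)

lemma deformed_tr_intertwine:
  assumes "\<And>u v. g (u + v) = g u + g v" "\<And>u v. g (u - v) = g u - g v"
    and "\<And>u. M (g u) = g (S u)" and "\<And>u v w. f (g u) (g v) (g w) = g (h u v w)"
  shows "deformed_tr M f (g u) (g v) (g w) = g (deformed_tr S h u v w)"
proof -
  have "M (g a + g b + g c) = g (S (a + b + c))" for a b c
    using assms(3)[of "a + b + c"] by (simp add: assms(1))
  then show ?thesis
    by (simp add: deformed_tr_def assms)
qed

context relative_rota_baxter_nijenhuis
begin

lemmas T_simps = linear_map_simps[OF T_linear]

lemma N_T_apply: "N (T u) = T (S u)"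
  using N_T by (simp add: fun_eq_iff)

abbreviation graph :: "'v \<Rightarrow> 'g \<times> 'v" where
  "graph u \<equiv> (T u, u)"

lemma semidirect_br_graph: "semidirect_br br \<rho> (graph u) (graph v) = graph (rb_br \<rho> T u v)"
  by (simp add: semidirect_br_def rb_br_def T_br[unfolded rb_br_def])

lemma semidirect_tr_graph:
  "semidirect_tr br tr \<rho> \<mu> (graph u) (graph v) (graph w) = graph (rb_tr br \<rho> \<mu> T u v w)"
  by (simp add: semidirect_tr_def rb_tr_def T_tr[unfolded rb_tr_def])

text \<open>
  The second components of these two equations say that the operations induced on \<open>V\<close> by \<open>T\<close> and the
  deformed representation are the \<open>S\<close>-deformations of those induced by \<open>T\<close> and \<open>(\<rho>, \<mu>)\<close>. The
  first components say that \<open>T\<close> maps them to the deformed operations of the algebra.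
\<close>

lemma semidirect_br_hat_graph:
  "semidirect_br (deformed_br N br) (hat_rho N S \<rho>) (graph u) (graph v)
     = graph (deformed_br S (rb_br \<rho> T) u v)"
  unfolding deformed_semidirect_br[symmetric]
  by (rule deformed_br_intertwine) (simp_all add: T_simps N_T_apply semidirect_br_graph)

lemma semidirect_tr_hat_graph:
  "semidirect_tr (deformed_br N br) (deformed_tr N tr) (hat_rho N S \<rho>) (hat_mu N S \<mu>)
       (graph u) (graph v) (graph w)
     = graph (deformed_tr S (rb_tr br \<rho> \<mu> T) u v w)"
  unfolding deformed_semidirect_tr[symmetric]
  by (rule deformed_tr_intertwine) (simp_all add: T_simps N_T_apply semidirect_tr_graph)

lemma relative_rota_baxter_deformed:
  "relative_rota_baxter scale (deformed_br N br) (deformed_tr N tr) scaleV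
     (hat_rho N S \<rho>) (hat_mu N S \<mu>) T"
proof (intro relative_rota_baxter.intro relative_rota_baxter_axioms.intro)
  show "lieyrep_pair scale (deformed_br N br) (deformed_tr N tr) scaleV
      (hat_rho N S \<rho>) (hat_mu N S \<mu>)"
    by (rule lieyrep_pair_deformed)
  show "Vector_Spaces.linear scaleV scale T" by (fact T_linear)
  show "deformed_br N br (T u) (T v) = T (rb_br (hat_rho N S \<rho>) T u v)" for u v
    using semidirect_br_hat_graph[of u v] by (simp add: semidirect_br_def rb_br_def)
  show "deformed_tr N tr (T u) (T v) (T w)
      = T (rb_tr (deformed_br N br) (hat_rho N S \<rho>) (hat_mu N S \<mu>) T u v w)" for u v w
    using semidirect_tr_hat_graph[of u v w] by (simp add: semidirect_tr_def rb_tr_def)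
qed

lemma relative_rota_baxter_compose: "relative_rota_baxter scale br tr scaleV \<rho> \<mu> (N \<circ> T)"
proof (intro relative_rota_baxter.intro relative_rota_baxter_axioms.intro)
  show "lieyrep_pair scale br tr scaleV \<rho> \<mu>" by (fact lieyrep_pair_axioms)
  show "Vector_Spaces.linear scaleV scale (N \<circ> T)"
    using T_linear N_linear by (rule Vector_Spaces.linear_compose)
  fix u v w
  have "T (rb_br \<rho> (N \<circ> T) u v) = deformed_br N br (T u) (T v)"
    using semidirect_br_hat_graph[of u v] by (simp add: semidirect_br_def br_S_eq)
  then show "br ((N \<circ> T) u) ((N \<circ> T) v) = (N \<circ> T) (rb_br \<rho> (N \<circ> T) u v)"
    by (simp add: N_br)
  have "T (rb_tr br \<rho> \<mu> (N \<circ> T) u v w) = deformed_tr N tr (T u) (T v) (T w)"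
    using semidirect_tr_hat_graph[of u v w] by (simp add: semidirect_tr_def tr_S_eq)
  then show "tr ((N \<circ> T) u) ((N \<circ> T) v) ((N \<circ> T) w) = (N \<circ> T) (rb_tr br \<rho> \<mu> (N \<circ> T) u v w)"
    by (simp add: N_tr)
qed

end

theorem theorem4p6:
  fixes scale :: "'k::field_char_0 \<Rightarrow> 'g::ab_group_add \<Rightarrow> 'g"
    and scaleV :: "'k \<Rightarrow> 'v::ab_group_add \<Rightarrow> 'v"
    and br :: "'g \<Rightarrow> 'g \<Rightarrow> 'g"
    and tr :: "'g \<Rightarrow> 'g \<Rightarrow> 'g \<Rightarrow> 'g"
    and \<rho> :: "'g \<Rightarrow> 'v \<Rightarrow> 'v"
    and \<mu> :: "'g \<Rightarrow> 'g \<Rightarrow> 'v \<Rightarrow> 'v"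
    and T :: "'v \<Rightarrow> 'g" and S :: "'v \<Rightarrow> 'v" and N :: "'g \<Rightarrow> 'g"
    and B :: "'g set" and BV :: "'v set"
  assumes "finite_dimensional_vector_space scale B"
    and "finite_dimensional_vector_space scaleV BV"
    and "relative_rota_baxter_nijenhuis scale br tr scaleV \<rho> \<mu> T S N"
  shows "relative_rota_baxter scale (deformed_br N br) (deformed_tr N tr) scaleV
           (hat_rho N S \<rho>) (hat_mu N S \<mu>) T
       \<and> relative_rota_baxter scale br tr scaleV \<rho> \<mu> (N \<circ> T)"
  using relative_rota_baxter_nijenhuis.relative_rota_baxter_deformed[OF assms(3)]
    relative_rota_baxter_nijenhuis.relative_rota_baxter_compose[OF assms(3)]
  by (rule conjI)

end
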